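(* Let $\alpha,\gamma\in\mathbb{C}$ with $\gamma\neq 0,-1,-2,\cdots$, and let ${}_{1}F_{1}(\alpha;\gamma;z)$ be the confluent hypergeometric function. Then its order satisfies $\sigma({}_{1}F_{1}(\alpha;\gamma;z))=1$ if $\alpha\notin\mathbb{Z}_{\leq 0}$, and $\sigma({}_{1}F_{1}(\alpha;\gamma;z))=0$ if $\alpha\in\mathbb{Z}_{\leq 0}$.
   Context: For $\alpha,\gamma\in\mathbb{C}$ with $\gamma\neq 0,-1,-2,\cdots$, the confluent hypergeometric (Kummer) function is the entire function of $z$ given by ${}_{1}F_{1}(\alpha;\gamma;z):=\sum_{n=0}^{\infty}\frac{(\alpha)_{n}}{n!(\gamma)_{n}}z^{n}$, where $(\alpha)_0=1$ and $(\alpha)_{n}=\alpha(\alpha+1)\cdots(\alpha+n-1)$. $\mathbb{Z}_{\leq 0}=\{0,-1,-2,\cdots\}$. The order of a meromorphic function $f$ is $\sigma(f)=\limsup_{r\to\infty}\frac{\log^{+}T(r,f)}{\log r}$, where $\log^{+}x=\max\{\log x,0\}$ (with $\log^{+}0=0$) and $T(r,f)$ is the Nevanlinna characteristic; for entire $f$, $T(r,f)=m(r,f)=\frac{1}{2\pi}\int_{0}^{2\pi}\log^{+}|f(re^{i\theta})|\,d\theta$. *)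

theory Defs
  imports "HOL-Complex_Analysis.Complex_Analysis" "HOL-Library.Nonpos_Ints"
begin

text \<open>
  The Kummer function. The series is meaningful for \<open>\<gamma> \<notin> \<int>\<^sub>\<le>\<^sub>0\<close>, where no denominator
  vanishes; it then converges for every \<open>z\<close>.
\<close>

definition hypergeo_1F1 :: "complex \<Rightarrow> complex \<Rightarrow> complex \<Rightarrow> complex" where
  "hypergeo_1F1 \<alpha> \<gamma> z = (\<Sum>n. pochhammer \<alpha> n / (fact n * pochhammer \<gamma> n) * z ^ n)"

text \<open>The positive part of the logarithm, with the convention \<open>log_plus 0 = 0\<close>.\<close>

definition log_plus :: "real \<Rightarrow> real" where
  "log_plus x = (if x \<le> 0 then 0 else max (ln x) 0)"

definition nevanlinna_m :: "real \<Rightarrow> (complex \<Rightarrow> complex) \<Rightarrow> real" where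
  "nevanlinna_m r f =
     1 / (2 * pi) * integral {0..2 * pi} (\<lambda>\<theta>. log_plus (cmod (f (of_real r * exp (\<i> * of_real \<theta>)))))"

text \<open>The number of poles in the closed disc of radius \<open>t\<close>, counted with multiplicity.\<close>

definition pole_count :: "real \<Rightarrow> (complex \<Rightarrow> complex) \<Rightarrow> real" where
  "pole_count t f = (\<Sum>z | cmod z \<le> t \<and> is_pole f z. of_int (- zorder f z))"

definition nevanlinna_N :: "real \<Rightarrow> (complex \<Rightarrow> complex) \<Rightarrow> real" where
  "nevanlinna_N r f =
     integral {0..r} (\<lambda>t. (pole_count t f - pole_count 0 f) / t) + pole_count 0 f * ln r"

definition nevanlinna_T :: "real \<Rightarrow> (complex \<Rightarrow> complex) \<Rightarrow> real" where
  "nevanlinna_T r f = nevanlinna_m r f + nevanlinna_N r f"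

text \<open>
  The order may be infinite, so the upper limit is taken in the extended reals.
\<close>

definition nevanlinna_order :: "(complex \<Rightarrow> complex) \<Rightarrow> ereal" where
  "nevanlinna_order f = Limsup at_top (\<lambda>r::real. ereal (log_plus (nevanlinna_T r f) / ln r))"

lemma nevanlinna_T_entire:
  assumes "f holomorphic_on UNIV"
  shows "nevanlinna_T r f = nevanlinna_m r f"
proof -
  have "\<not> is_pole f z" for z
    using assms not_is_pole_holomorphic[of UNIV z f] by auto
  then have "pole_count t f = 0" for t
    by (simp add: pole_count_def)
  then show ?thesis
    by (simp add: nevanlinna_T_def nevanlinna_N_def)
qed

end

theory Submission
  imports Defs "HOL-Real_Asymp.Real_Asymp"
begin

text \<open>
  The coefficients \<open>a\<^sub>n\<close> of the Kummer series have size about \<open>1 / n!\<close>: if \<open>\<alpha>\<close> and \<open>\<gamma>\<close> are not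
  in \<open>\<int>\<^sub>\<le>\<^sub>0\<close>, the ratio \<open>(\<alpha> + n) / (\<gamma> + n)\<close> is bounded, and bounded away from 0, so
  \<open>K\<^sup>-\<^sup>n / n! \<le> \<bar>a\<^sub>n\<bar> \<le> K\<^sup>n / n!\<close> for some \<open>K\<close>. The upper bound, valid for every \<open>\<alpha>\<close>, makes the function entire
  with \<open>\<bar>f z\<bar> \<le> exp (K \<bar>z\<bar>)\<close>. Hence \<open>T(r, f) \<le> K r\<close>, and the order is at most 1. If \<open>\<alpha> \<in> \<int>\<^sub>\<le>\<^sub>0\<close>, then
  \<open>f\<close> is a polynomial, \<open>T(r, f)\<close> grows at most logarithmically, and the order is 0.

  The remaining part is that the order is at least 1 when \<open>\<alpha> \<notin> \<int>\<^sub>\<le>\<^sub>0\<close>. The coefficients control the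
  maximum modulus through Cauchy's inequality, while the order is defined by the mean value \<open>T(r, f)\<close>,
  which could be much smaller. The link is the classical inequality
  \<open>\<bar>f z\<bar> \<le> exp ((r + \<bar>z\<bar>) / (r - \<bar>z\<bar>) T(r, f))\<close> (lemma \<open>cmod_le_exp_nevanlinna_T\<close>), usually derived
  from the Poisson-Jensen formula. The proof here avoids that formula, and with it the zeros of \<open>f\<close>:
  on the unit circle the continuous function \<open>log\<^sup>+ \<bar>f\<bar>\<close> is bounded above, with small error, by the
  real part of a polynomial \<open>P\<close>. The maximum principle for \<open>f exp (- P)\<close> extends
  \<open>\<bar>f\<bar> \<le> exp (Re P)\<close> to the disc, Harnack's inequality bounds \<open>Re P\<close> by \<open>Re (P 0)\<close>, and \<open>Re (P 0)\<close>
  is the mean of \<open>Re P\<close> over the circle, thus nearly \<open>T(1, f)\<close>.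

  With \<open>\<bar>z\<bar> = r / 2\<close> this and Cauchy's inequality give \<open>\<bar>a\<^sub>n\<bar> (r / 2)\<^sup>n \<le> exp (3 T(r, f))\<close>. For
  \<open>r = 2 e K n\<close> the left-hand side is at least \<open>e\<^sup>n\<close>, so \<open>T(r, f) \<ge> n / 3\<close>, which is linear in \<open>r\<close>.
\<close>

section \<open>Growth of an entire function in terms of its proximity function\<close>

text \<open>
  On the unit circle \<open>z * cnj z = 1\<close>, so each mixed term \<open>z\<^sup>j * cnj z\<^sup>k\<close> collapses to a power of \<open>z\<close>
  or of \<open>cnj z\<close>, and the real part does not distinguish the two.
\<close>

lemma Re_poly_mult_cnj_unit_circle:
  fixes P Q :: "complex poly"
  shows "\<exists>R. \<forall>z. cmod z = 1 \<longrightarrow> Re (poly P z * cnj (poly Q z)) = Re (poly R z)"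
proof (induction P Q rule: poly_induct2)
  case 0
  show ?case by (rule exI[of _ 0]) simp
next
  case (pCons a p b q)
  then obtain R where R: "Re (poly p z * cnj (poly q z)) = Re (poly R z)" if "cmod z = 1" for z
    by blast
  define S where "S = [:a * cnj b:] + pCons 0 (smult (cnj a) q) + pCons 0 (smult (cnj b) p) + R"
  have "Re (poly (pCons a p) z * cnj (poly (pCons b q) z)) = Re (poly S z)" if z: "cmod z = 1" for z
  proof -
    have "z * cnj z = 1"
      using z by (simp add: complex_norm_square [symmetric])
    then have "poly (pCons a p) z * cnj (poly (pCons b q) z) =
        a * cnj b + cnj (cnj a * z * poly q z) + cnj b * z * poly p z + poly p z * cnj (poly q z)"
      by (simp add: algebra_simps)
    then have "Re (poly (pCons a p) z * cnj (poly (pCons b q) z)) =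
        Re (a * cnj b) + Re (cnj a * z * poly q z) + Re (cnj b * z * poly p z) + Re (poly R z)"
      using R[OF z] by (simp only: plus_complex.simps complex_cnj cnj.sel)
    then show ?thesis
      by (simp add: S_def algebra_simps)
  qed
  then show ?case by blast
qed

text \<open>
  This turns the real Stone-Weierstrass theorem into an approximation theorem by real parts of
  polynomials, that is, by functions harmonic in the whole disc. Only closure under products needs an
  argument: \<open>Re a * Re b\<close> is half of \<open>Re (a * b) + Re (a * cnj b)\<close>.
\<close>

lemma real_polynomial_function_eq_Re_poly_on_unit_circle:
  fixes g :: "complex \<Rightarrow> real"
  assumes "real_polynomial_function g"
  shows "\<exists>P. \<forall>z. cmod z = 1 \<longrightarrow> g z = Re (poly P z)"
  using assms
proof induction
  case (linear g)
  then interpret bounded_linear g .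
  have "g z = Re (poly [:0, of_real (g 1) - \<i> * of_real (g \<i>):] z)" for z
  proof -
    have "g z = g (Re z *\<^sub>R 1 + Im z *\<^sub>R \<i>)"
      by (simp add: scaleR_conv_of_real mult.commute flip: complex_eq)
    then show ?thesis
      by (simp only: add scale) simp
  qed
  then show ?case by blast
next
  case (const c)
  show ?case by (rule exI[of _ "[:of_real c:]"]) simp
next
  case (add f g)
  then obtain P Q where "\<forall>z. cmod z = 1 \<longrightarrow> f z = Re (poly P z)"
      "\<forall>z. cmod z = 1 \<longrightarrow> g z = Re (poly Q z)"
    by blast
  then show ?case by (intro exI[of _ "P + Q"]) simp
next
  case (mult f g)
  then obtain P Q where PQ: "\<forall>z. cmod z = 1 \<longrightarrow> f z = Re (poly P z)"
      "\<forall>z. cmod z = 1 \<longrightarrow> g z = Re (poly Q z)"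
    by blast
  obtain R where R: "\<forall>z. cmod z = 1 \<longrightarrow> Re (poly P z * cnj (poly Q z)) = Re (poly R z)"
    using Re_poly_mult_cnj_unit_circle by blast
  have "Re a * Re b = (Re (a * b) + Re (a * cnj b)) / 2" for a b
    by simp
  then have "f z * g z = Re (poly (smult (1/2) (P * Q + R)) z)" if "cmod z = 1" for z
    using PQ(1,2)[rule_format, OF that] R[rule_format, OF that] that
    by (simp only: poly_smult poly_add poly_mult) simp
  then show ?case by blast
qed

text \<open>
  A Cayley transform maps the right half-plane to the disc and \<open>P 0\<close> to 0, so that the Schwarz lemma
  applies; the estimate is the resulting \<open>\<bar>P z - P 0\<bar> \<le> \<bar>z\<bar> \<bar>P z + cnj (P 0)\<bar>\<close>, read on real parts.
\<close>

lemma Harnack_upper_bound: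
  assumes holo: "P holomorphic_on ball 0 1"
    and pos: "\<And>w. cmod w < 1 \<Longrightarrow> Re (P w) > 0"
    and z: "cmod z < 1"
  shows "Re (P z) \<le> (1 + cmod z) / (1 - cmod z) * Re (P 0)"
proof -
  define g where "g w = (P w - P 0) / (P w + cnj (P 0))" for w
  have den: "P w + cnj (P 0) \<noteq> 0" if "cmod w < 1" for w
    using pos[OF that] pos[of 0] by (auto simp: complex_eq_iff)
  have sq: "(cmod (P w - P 0))\<^sup>2 = (Re (P w) - Re (P 0))\<^sup>2 + (Im (P w) - Im (P 0))\<^sup>2"
      "(cmod (P w + cnj (P 0)))\<^sup>2 = (Re (P w) + Re (P 0))\<^sup>2 + (Im (P w) - Im (P 0))\<^sup>2" for w
    by (simp_all add: cmod_power2)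
  have "cmod (g w) < 1" if w: "cmod w < 1" for w
  proof -
    have "Re (P w) * Re (P 0) > 0"
      using pos[OF w] pos[of 0] by simp
    then have "(cmod (P w - P 0))\<^sup>2 < (cmod (P w + cnj (P 0)))\<^sup>2"
      unfolding sq by (simp add: power2_sum power2_diff mult.commute)
    then have "cmod (P w - P 0) < cmod (P w + cnj (P 0))"
      using power2_less_imp_less norm_ge_zero by blast
    then show ?thesis
      using den[OF w] by (simp add: g_def norm_divide)
  qed
  moreover have "g holomorphic_on ball 0 1"
    unfolding g_def using den by (intro holomorphic_intros holo) auto
  moreover have "g 0 = 0" by (simp add: g_def)
  ultimately have "cmod (g z) \<le> cmod z"
    using Schwarz_Lemma(1)[of g z] z by blast
  then have "cmod (P z - P 0) \<le> cmod z * cmod (P z + cnj (P 0))"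
    using den[OF z] by (simp add: g_def norm_divide field_simps)
  then have "(cmod (P z - P 0))\<^sup>2 \<le> (cmod z)\<^sup>2 * (cmod (P z + cnj (P 0)))\<^sup>2"
    by (metis norm_ge_zero power_mono power_mult_distrib)
  moreover have "(cmod z)\<^sup>2 * (Im (P z) - Im (P 0))\<^sup>2 \<le> 1 * (Im (P z) - Im (P 0))\<^sup>2"
    using z by (intro mult_right_mono) (simp_all add: power_le_one)
  ultimately have "(Re (P z) - Re (P 0))\<^sup>2 \<le> (cmod z)\<^sup>2 * (Re (P z) + Re (P 0))\<^sup>2"
    unfolding sq by (simp add: distrib_left)
  then have "(Re (P z) - Re (P 0))\<^sup>2 \<le> (cmod z * (Re (P z) + Re (P 0)))\<^sup>2"
    by (simp add: power_mult_distrib)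
  then have "Re (P z) - Re (P 0) \<le> cmod z * (Re (P z) + Re (P 0))"
    by (rule power2_le_imp_le) (use pos[OF z] pos[of 0] in auto)
  then show ?thesis
    using z by (simp add: field_simps)
qed

lemma mean_value_unit_circle:
  fixes f :: "complex \<Rightarrow> complex"
  assumes "f holomorphic_on UNIV"
  shows "((\<lambda>t. f (cis t)) has_integral 2 * pi * f 0) {0..2 * pi}"
proof -
  have "((\<lambda>u. f u / (u - 0)) has_contour_integral 2 * of_real pi * \<i> * f 0) (circlepath 0 1)"
    using assms by (intro Cauchy_integral_circlepath_simple) (auto intro: holomorphic_on_subset)
  then have "((\<lambda>t. f (cis t) * \<i>) has_integral 2 * pi * \<i> * f 0) {0..2 * pi}"
    unfolding circlepath_def by (subst (asm) has_contour_integral_part_circlepath_iff) simp_all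
  then have "((\<lambda>t. f (cis t) * \<i> * (- \<i>)) has_integral 2 * pi * \<i> * f 0 * (- \<i>)) {0..2 * pi}"
    by (rule has_integral_mult_left)
  then show ?thesis by (simp add: algebra_simps)
qed

lemma log_plus_eq: "log_plus x = ln (max 1 x)"
  by (auto simp: log_plus_def max_def)

lemma log_plus_nonneg: "log_plus x \<ge> 0"
  by (simp add: log_plus_eq)

lemma log_plus_mono: "x \<le> y \<Longrightarrow> log_plus x \<le> log_plus y"
  by (simp add: log_plus_eq)

lemma le_exp_log_plus: "x \<le> exp (log_plus x)"
  by (simp add: log_plus_eq)

lemma continuous_on_log_plus [continuous_intros]:
  "continuous_on S f \<Longrightarrow> continuous_on S (\<lambda>x. log_plus (f x))"
  unfolding log_plus_eq by (intro continuous_intros) (auto simp: max_def)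

text \<open>
  The Poisson integral of \<open>log\<^sup>+ \<bar>f\<bar>\<close> is the natural harmonic majorant of \<open>log \<bar>f\<bar>\<close>. Replacing it by
  \<open>Re P\<close> for a polynomial \<open>P\<close>, at the cost of an arbitrarily small \<open>\<epsilon>\<close>, gives a function that is
  harmonic across the circle, and boundary behaviour is no issue.
\<close>

lemma cmod_le_exp_mean_log_plus_unit_circle:
  assumes holo: "f holomorphic_on UNIV" and z: "cmod z < 1"
  shows "cmod (f z) \<le> exp ((1 + cmod z) / (1 - cmod z) *
           (integral {0..2 * pi} (\<lambda>t. log_plus (cmod (f (cis t)))) / (2 * pi)))"
proof -
  define u where "u w = log_plus (cmod (f w))" for w
  define T where "T = integral {0..2 * pi} (\<lambda>t. u (cis t)) / (2 * pi)"
  define C where "C = (1 + cmod z) / (1 - cmod z)"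
  have C: "C > 0" using z by (simp add: C_def add_pos_nonneg)
  have contf: "continuous_on S f" for S
    using holo holomorphic_on_imp_continuous_on continuous_on_subset by blast
  have contu: "continuous_on S u" for S
    unfolding u_def by (intro continuous_intros contf)
  have contuc: "continuous_on S (\<lambda>t. u (cis t))" for S
    by (rule continuous_on_compose2[OF contu[of UNIV]]) (auto intro!: continuous_intros)
  have bound: "cmod (f z) \<le> exp (C * (T + 3 * \<epsilon>))" if \<epsilon>: "\<epsilon> > 0" for \<epsilon>
  proof -
    \<comment> \<open>Approximating \<open>u + 2 * \<epsilon>\<close> within \<open>\<epsilon>\<close> makes the approximant an upper bound for \<open>u\<close> that is at
      least \<open>\<epsilon>\<close>, as the strict positivity in Harnack's inequality requires.\<close>
    obtain g where g: "real_polynomial_function g"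
        "\<And>w. w \<in> sphere 0 1 \<Longrightarrow> \<bar>(u w + 2 * \<epsilon>) - g w\<bar> < \<epsilon>"
      by (rule Stone_Weierstrass_real_polynomial_function
            [of "sphere 0 1" "\<lambda>w. u w + 2 * \<epsilon>" \<epsilon>])
        (use \<epsilon> in \<open>auto intro!: continuous_intros contu\<close>)
    obtain P where P: "\<And>w. cmod w = 1 \<Longrightarrow> g w = Re (poly P w)"
      using real_polynomial_function_eq_Re_poly_on_unit_circle[OF g(1)] by blast
    have lower: "u w + \<epsilon> \<le> Re (poly P w)" and upper: "Re (poly P w) \<le> u w + 3 * \<epsilon>"
      if "cmod w = 1" for w
      using g(2)[of w] P[OF that] that by auto
    have "Re (- poly P w) \<le> - \<epsilon>" if "cmod w < 1" for w
    proof (rule maximum_real_frontier[where f = "\<lambda>w. - poly P w" and S = "ball 0 1"])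
      fix v :: complex assume "v \<in> frontier (ball 0 1)"
      then have "cmod v = 1" by simp
      then show "Re (- poly P v) \<le> - \<epsilon>"
        using lower[of v] log_plus_nonneg[of "cmod (f v)"] by (simp add: u_def)
    qed (use that in \<open>auto intro!: holomorphic_intros continuous_intros\<close>)
    then have posP: "Re (poly P w) > 0" if "cmod w < 1" for w
      using \<epsilon> that by fastforce
    have "Re (poly P z) \<le> C * Re (poly P 0)"
      unfolding C_def using posP z by (intro Harnack_upper_bound holomorphic_intros) auto
    also have "Re (poly P 0) \<le> T + 3 * \<epsilon>"
    proof -
      have "((\<lambda>t. poly P (cis t)) has_integral 2 * pi * poly P 0) {0..2 * pi}"
        by (intro mean_value_unit_circle holomorphic_intros)
      then have "((\<lambda>t. Re (poly P (cis t))) has_integral Re (2 * pi * poly P 0)) {0..2 * pi}"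
        by (rule has_integral_Re)
      moreover have "((\<lambda>t. u (cis t) + 3 * \<epsilon>) has_integral (2 * pi * T + 2 * pi * (3 * \<epsilon>))) {0..2 * pi}"
      proof (rule has_integral_add)
        show "((\<lambda>t. u (cis t)) has_integral 2 * pi * T) {0..2 * pi}"
          using integrable_integral[OF integrable_continuous_interval[OF contuc[of "{0..2 * pi}"]]]
          by (simp add: T_def)
        show "((\<lambda>t. 3 * \<epsilon>) has_integral 2 * pi * (3 * \<epsilon>)) {0..2 * pi}"
          using has_integral_const_real[of "3 * \<epsilon>" 0 "2 * pi"] by simp
      qed
      ultimately have "Re (2 * pi * poly P 0) \<le> 2 * pi * T + 2 * pi * (3 * \<epsilon>)"
        by (rule has_integral_le) (use upper in auto)
      then have "2 * pi * Re (poly P 0) \<le> 2 * pi * (T + 3 * \<epsilon>)"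
        by (simp add: algebra_simps)
      then show ?thesis
        by (rule mult_left_le_imp_le) simp
    qed
    finally have ReP: "Re (poly P z) \<le> C * (T + 3 * \<epsilon>)"
      using C by (simp add: mult_left_mono)
    have "cmod (f z * exp (- poly P z)) \<le> 1"
    proof (rule maximum_modulus_frontier[where f = "\<lambda>w. f w * exp (- poly P w)" and S = "ball 0 1"])
      fix v :: complex assume "v \<in> frontier (ball 0 1)"
      then have v: "cmod v = 1" by simp
      have "cmod (f v) \<le> exp (u v)"
        by (simp add: u_def le_exp_log_plus)
      also have "\<dots> \<le> exp (Re (poly P v))"
        using lower[OF v] \<epsilon> by simp
      finally show "cmod (f v * exp (- poly P v)) \<le> 1"
        by (simp add: norm_mult norm_divide exp_minus field_simps)
    qed (use z in \<open>auto intro!: holomorphic_intros continuous_intros contf holomorphic_on_subset[OF holo]\<close>)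
    then have "cmod (f z) \<le> exp (Re (poly P z))"
      by (simp add: norm_mult norm_divide exp_minus field_simps)
    with ReP show ?thesis
      by (meson exp_le_cancel_iff order_trans)
  qed
  have "cmod (f z) \<le> exp (C * T)"
  proof (cases "f z = 0")
    case False
    have "ln (cmod (f z)) \<le> C * T + e" if "e > 0" for e
    proof -
      have "cmod (f z) \<le> exp (C * T + e)"
        using bound[of "e / (3 * C)"] that C by (simp add: algebra_simps)
      then show ?thesis
        using False by (metis exp_le_cancel_iff exp_ln zero_less_norm_iff)
    qed
    then have "ln (cmod (f z)) \<le> C * T"
      by (rule field_le_epsilon)
    then show ?thesis
      using False by (metis exp_le_cancel_iff exp_ln zero_less_norm_iff)
  qed simp
  then show ?thesis
    by (simp add: C_def T_def u_def)
qed

lemma cmod_le_exp_nevanlinna_T: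
  assumes holo: "f holomorphic_on UNIV" and z: "cmod z < r"
  shows "cmod (f z) \<le> exp ((r + cmod z) / (r - cmod z) * nevanlinna_T r f)"
proof -
  define w where "w = z / of_real r"
  have r: "r > 0" using z by (meson norm_ge_zero order.strict_trans1)
  have w: "cmod w = cmod z / r"
    using r by (simp add: w_def norm_divide)
  have "(\<lambda>w. f (of_real r * w)) holomorphic_on UNIV"
    using holomorphic_on_compose_gen[OF _ holo, of "\<lambda>w. of_real r * w" UNIV]
    by (auto simp: o_def intro!: holomorphic_intros)
  from cmod_le_exp_mean_log_plus_unit_circle[OF this, of w]
  have "cmod (f z) \<le> exp ((1 + cmod w) / (1 - cmod w) * nevanlinna_T r f)"
    using r z by (simp add: nevanlinna_T_entire[OF holo] nevanlinna_m_def w cis_conv_exp)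
      (simp add: w_def)
  also have "(1 + cmod w) / (1 - cmod w) = (r + cmod z) / (r - cmod z)"
    using r z unfolding w by (simp add: field_simps)
  finally show ?thesis .
qed

section \<open>Bounding the order\<close>

lemma nevanlinna_T_leI:
  assumes holo: "f holomorphic_on UNIV" and "r \<ge> 0" "B \<ge> 0"
    and bound: "\<And>z. cmod z = r \<Longrightarrow> cmod (f z) \<le> exp B"
  shows "nevanlinna_T r f \<le> B"
proof -
  have "integral {0..2 * pi} (\<lambda>\<theta>. log_plus (cmod (f (of_real r * exp (\<i> * of_real \<theta>)))))
      \<le> integral {0..2 * pi} (\<lambda>_. B)"
  proof (rule integral_le)
    show "(\<lambda>\<theta>. log_plus (cmod (f (of_real r * exp (\<i> * of_real \<theta>))))) integrable_on {0..2 * pi}"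
      by (intro integrable_continuous_interval continuous_intros
            continuous_on_compose2[OF holomorphic_on_imp_continuous_on[OF holo]]) auto
    fix \<theta> :: real
    have "cmod (of_real r * exp (\<i> * of_real \<theta>)) = r"
      using \<open>r \<ge> 0\<close> by (simp add: norm_mult)
    then have "log_plus (cmod (f (of_real r * exp (\<i> * of_real \<theta>)))) \<le> log_plus (exp B)"
      by (intro log_plus_mono bound)
    also have "log_plus (exp B) = B"
      using \<open>B \<ge> 0\<close> by (simp add: log_plus_def)
    finally show "log_plus (cmod (f (of_real r * exp (\<i> * of_real \<theta>)))) \<le> B" .
  qed (rule integrable_const_ivl)
  then show ?thesis
    by (simp add: nevanlinna_T_entire[OF holo] nevanlinna_m_def field_simps)
qed

lemma nevanlinna_order_nonneg: "nevanlinna_order f \<ge> 0"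
  unfolding nevanlinna_order_def
proof (rule le_Limsup)
  show "\<forall>\<^sub>F r in at_top. 0 \<le> ereal (log_plus (nevanlinna_T r f) / ln r)"
    using eventually_gt_at_top[of 1] by eventually_elim (simp add: log_plus_nonneg)
qed simp

lemma nevanlinna_order_leI:
  assumes le: "\<forall>\<^sub>F r in at_top. nevanlinna_T r f \<le> g r"
    and ge1: "\<forall>\<^sub>F r in at_top. 1 \<le> g r"
    and lim: "((\<lambda>r. ln (g r) / ln r) \<longlongrightarrow> L) at_top"
  shows "nevanlinna_order f \<le> ereal L"
proof -
  have "\<forall>\<^sub>F r in at_top. ereal (log_plus (nevanlinna_T r f) / ln r) \<le> ereal (ln (g r) / ln r)"
    using le ge1 eventually_gt_at_top[of 1]
  proof eventually_elim
    case (elim r)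
    then have "log_plus (nevanlinna_T r f) \<le> ln (g r)"
      using log_plus_mono[of "nevanlinna_T r f" "g r"] by (simp add: log_plus_eq)
    with elim show ?case by (simp add: divide_right_mono)
  qed
  then have "nevanlinna_order f \<le> Limsup at_top (\<lambda>r. ereal (ln (g r) / ln r))"
    unfolding nevanlinna_order_def by (rule Limsup_mono)
  also have "\<dots> = ereal L"
    using lim by (intro lim_imp_Limsup tendsto_intros) simp_all
  finally show ?thesis .
qed

lemma nevanlinna_order_geI:
  assumes r: "filterlim r at_top sequentially"
    and ge: "\<forall>\<^sub>F n in sequentially. 0 < g n \<and> g n \<le> nevanlinna_T (r n) f"
    and lim: "(\<lambda>n. ln (g n) / ln (r n)) \<longlonglongrightarrow> L"
  shows "ereal L \<le> nevanlinna_order f"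
proof -
  have "ereal L = Limsup sequentially (\<lambda>n. ereal (ln (g n) / ln (r n)))"
    using lim by (intro lim_imp_Limsup[symmetric] tendsto_intros) simp_all
  also have "\<dots> \<le> Limsup sequentially (\<lambda>n. ereal (log_plus (nevanlinna_T (r n) f) / ln (r n)))"
  proof (rule Limsup_mono)
    have "\<forall>\<^sub>F n in sequentially. r n > 1"
      using r by (simp add: filterlim_at_top_dense)
    then show "\<forall>\<^sub>F n in sequentially.
        ereal (ln (g n) / ln (r n)) \<le> ereal (log_plus (nevanlinna_T (r n) f) / ln (r n))"
      using ge
    proof eventually_elim
      case (elim n)
      then have "ln (g n) \<le> log_plus (nevanlinna_T (r n) f)"
        by (auto simp: log_plus_eq le_max_iff_disj)
      with elim show ?case by (simp add: divide_right_mono)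
    qed
  qed
  also have "\<dots> \<le> nevanlinna_order f"
    unfolding nevanlinna_order_def
  proof (subst Limsup_le_iff, intro allI impI)
    fix y assume "Limsup at_top (\<lambda>r. ereal (log_plus (nevanlinna_T r f) / ln r)) < y"
    then show "\<forall>\<^sub>F n in sequentially. ereal (log_plus (nevanlinna_T (r n) f) / ln (r n)) < y"
      using eventually_compose_filterlim[OF Limsup_lessD r] by blast
  qed
  finally show ?thesis .
qed

section \<open>The coefficients of the Kummer series\<close>

text \<open>
  The factors satisfy \<open>\<bar>a + n\<bar> \<le> \<bar>a - c\<bar> + \<bar>c + n\<bar>\<close>, and \<open>\<bar>c + n\<bar>\<close> is at least the distance from \<open>c\<close>
  to the closed set \<open>\<int>\<^sub>\<le>\<^sub>0\<close>. The roles of \<open>\<alpha>\<close> and \<open>\<gamma>\<close> can be exchanged, so this one estimate bounds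
  the coefficients of the Kummer series from both sides.
\<close>

lemma norm_pochhammer_le_geometric:
  fixes a c :: complex
  assumes "c \<notin> \<int>\<^sub>\<le>\<^sub>0"
  obtains K where "K > 0" "\<And>n. cmod (pochhammer a n) \<le> K ^ n * cmod (pochhammer c n)"
proof -
  obtain d where d: "d > 0" "\<And>x. x \<in> \<int>\<^sub>\<le>\<^sub>0 \<Longrightarrow> d \<le> dist c x"
    using separate_point_closed[OF closed_nonpos_Ints assms] by blast
  define K where "K = 1 + cmod (a - c) / d"
  have K: "K > 0"
    unfolding K_def using d(1) by (intro add_pos_nonneg) simp_all
  have factor: "cmod (a + of_nat n) \<le> K * cmod (c + of_nat n)" for n
  proof -
    have "d \<le> cmod (c + of_nat n)"
      using d(2)[of "- of_nat n"] by (simp add: dist_norm)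
    then have "cmod (a - c) * d \<le> cmod (a - c) * cmod (c + of_nat n)"
      by (rule mult_left_mono) simp
    then have "cmod (a - c) \<le> cmod (a - c) / d * cmod (c + of_nat n)"
      using d(1) by (simp add: field_simps)
    moreover have "cmod (a + of_nat n) \<le> cmod (a - c) + cmod (c + of_nat n)"
      using norm_triangle_ineq[of "a - c" "c + of_nat n"] by simp
    ultimately show ?thesis
      by (simp add: K_def distrib_right)
  qed
  have "cmod (pochhammer a n) \<le> K ^ n * cmod (pochhammer c n)" for n
  proof (induction n)
    case (Suc n)
    have "cmod (pochhammer a n) * cmod (a + of_nat n)
        \<le> (K ^ n * cmod (pochhammer c n)) * (K * cmod (c + of_nat n))"
      using Suc.IH factor K by (intro mult_mono) auto
    then show ?case
      by (simp add: pochhammer_Suc norm_mult mult_ac)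
  qed simp
  with K that show thesis by blast
qed

definition kummer_fps :: "complex \<Rightarrow> complex \<Rightarrow> complex fps" where
  "kummer_fps \<alpha> \<gamma> = Abs_fps (\<lambda>n. pochhammer \<alpha> n / (fact n * pochhammer \<gamma> n))"

lemma pochhammer_nonzero: "c \<notin> \<int>\<^sub>\<le>\<^sub>0 \<Longrightarrow> pochhammer (c :: complex) n \<noteq> 0"
  using pochhammer_eq_0_imp_nonpos_Int by blast

lemma norm_kummer_term_le:
  assumes "\<gamma> \<notin> \<int>\<^sub>\<le>\<^sub>0"
  obtains K where "K > 0"
    "\<And>n z. cmod (fps_nth (kummer_fps \<alpha> \<gamma>) n * z ^ n) \<le> inverse (fact n) * (K * cmod z) ^ n"
proof -
  obtain K where K: "K > 0" "\<And>n. cmod (pochhammer \<alpha> n) \<le> K ^ n * cmod (pochhammer \<gamma> n)"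
    using norm_pochhammer_le_geometric[OF assms] by blast
  have "cmod (fps_nth (kummer_fps \<alpha> \<gamma>) n * z ^ n) \<le> inverse (fact n) * (K * cmod z) ^ n" for n z
  proof -
    have "cmod (pochhammer \<gamma> n) > 0"
      using pochhammer_nonzero[OF assms] by simp
    then have "cmod (pochhammer \<alpha> n) / cmod (pochhammer \<gamma> n) \<le> K ^ n"
      using K(2)[of n] by (simp add: pos_divide_le_eq)
    then have "inverse (fact n) * (cmod (pochhammer \<alpha> n) / cmod (pochhammer \<gamma> n)) * cmod z ^ n
        \<le> inverse (fact n) * K ^ n * cmod z ^ n"
      by (intro mult_right_mono mult_left_mono) simp_all
    also have "inverse (fact n) * (cmod (pochhammer \<alpha> n) / cmod (pochhammer \<gamma> n)) * cmod z ^ n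
        = cmod (fps_nth (kummer_fps \<alpha> \<gamma>) n * z ^ n)"
      by (simp add: kummer_fps_def norm_divide norm_mult norm_power divide_simps)
    finally show ?thesis
      by (simp add: power_mult_distrib mult.assoc)
  qed
  with K(1) show thesis by (rule that)
qed

lemma norm_kummer_fps_nth_ge:
  assumes "\<alpha> \<notin> \<int>\<^sub>\<le>\<^sub>0" "\<gamma> \<notin> \<int>\<^sub>\<le>\<^sub>0"
  obtains K where "K > 0" "\<And>n. 1 / (K ^ n * fact n) \<le> cmod (fps_nth (kummer_fps \<alpha> \<gamma>) n)"
proof -
  obtain K where K: "K > 0" "\<And>n. cmod (pochhammer \<gamma> n) \<le> K ^ n * cmod (pochhammer \<alpha> n)"
    using norm_pochhammer_le_geometric[OF assms(1)] by blast
  have "1 / (K ^ n * fact n) \<le> cmod (fps_nth (kummer_fps \<alpha> \<gamma>) n)" for n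
  proof -
    have "cmod (pochhammer \<gamma> n) > 0"
      using pochhammer_nonzero[OF assms(2)] by simp
    then have "1 / K ^ n \<le> cmod (pochhammer \<alpha> n) / cmod (pochhammer \<gamma> n)"
      using K(1) K(2)[of n] by (simp add: frac_le_eq pos_divide_le_eq pos_le_divide_eq mult.commute)
    then have "1 / K ^ n / fact n \<le> cmod (pochhammer \<alpha> n) / cmod (pochhammer \<gamma> n) / fact n"
      by (rule divide_right_mono) simp
    then show ?thesis
      by (simp add: kummer_fps_def norm_divide norm_mult mult.commute)
  qed
  with K(1) show thesis by (rule that)
qed

lemma hypergeo_1F1_eq_eval_fps: "hypergeo_1F1 \<alpha> \<gamma> = eval_fps (kummer_fps \<alpha> \<gamma>)"
  by (simp add: hypergeo_1F1_def eval_fps_def kummer_fps_def fun_eq_iff)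

lemma summable_norm_kummer:
  assumes "\<gamma> \<notin> \<int>\<^sub>\<le>\<^sub>0"
  shows "summable (\<lambda>n. cmod (fps_nth (kummer_fps \<alpha> \<gamma>) n * z ^ n))"
proof -
  obtain K where K: "K > 0"
      "\<And>n z. cmod (fps_nth (kummer_fps \<alpha> \<gamma>) n * z ^ n) \<le> inverse (fact n) * (K * cmod z) ^ n"
    using norm_kummer_term_le[OF assms, of \<alpha>] by metis
  show ?thesis
    by (rule summable_comparison_test'[where N = 0, OF summable_exp[of "K * cmod z"]]) (simp only: real_norm_def abs_norm_cancel K(2))
qed

lemma fps_conv_radius_kummer:
  assumes "\<gamma> \<notin> \<int>\<^sub>\<le>\<^sub>0"
  shows "fps_conv_radius (kummer_fps \<alpha> \<gamma>) = \<infinity>"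
  unfolding fps_conv_radius_def
  using summable_norm_kummer[OF assms] by (intro conv_radius_inftyI'') (rule summable_norm_cancel)

lemma hypergeo_1F1_holomorphic:
  assumes "\<gamma> \<notin> \<int>\<^sub>\<le>\<^sub>0"
  shows "hypergeo_1F1 \<alpha> \<gamma> holomorphic_on A"
  unfolding hypergeo_1F1_eq_eval_fps
  by (rule holomorphic_on_eval_fps) (simp add: fps_conv_radius_kummer[OF assms])

lemma norm_hypergeo_1F1_le_exp:
  assumes "\<gamma> \<notin> \<int>\<^sub>\<le>\<^sub>0"
  obtains K where "K > 0" "\<And>z. cmod (hypergeo_1F1 \<alpha> \<gamma> z) \<le> exp (K * cmod z)"
proof -
  obtain K where K: "K > 0"
      "\<And>n z. cmod (fps_nth (kummer_fps \<alpha> \<gamma>) n * z ^ n) \<le> inverse (fact n) * (K * cmod z) ^ n"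
    using norm_kummer_term_le[OF assms, of \<alpha>] by metis
  have "cmod (hypergeo_1F1 \<alpha> \<gamma> z) \<le> exp (K * cmod z)" for z
  proof -
    have "cmod (hypergeo_1F1 \<alpha> \<gamma> z) \<le> (\<Sum>n. cmod (fps_nth (kummer_fps \<alpha> \<gamma>) n * z ^ n))"
      unfolding hypergeo_1F1_eq_eval_fps eval_fps_def
      by (intro summable_norm summable_norm_kummer assms)
    also have "\<dots> \<le> (\<Sum>n. inverse (fact n) * (K * cmod z) ^ n)"
      by (intro suminf_le summable_norm_kummer assms summable_exp K(2))
    also have "\<dots> = exp (K * cmod z)"
      by (simp add: exp_def)
    finally show ?thesis .
  qed
  with K(1) show thesis by (rule that)
qed

section \<open>The order of the Kummer function\<close>

lemma nevanlinna_order_hypergeo_1F1_le_1: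
  assumes "\<gamma> \<notin> \<int>\<^sub>\<le>\<^sub>0"
  shows "nevanlinna_order (hypergeo_1F1 \<alpha> \<gamma>) \<le> 1"
proof -
  obtain K where K: "K > 0" "\<And>z. cmod (hypergeo_1F1 \<alpha> \<gamma> z) \<le> exp (K * cmod z)"
    using norm_hypergeo_1F1_le_exp[OF assms] by blast
  have "nevanlinna_order (hypergeo_1F1 \<alpha> \<gamma>) \<le> ereal 1"
  proof (rule nevanlinna_order_leI)
    show "\<forall>\<^sub>F r in at_top. nevanlinna_T r (hypergeo_1F1 \<alpha> \<gamma>) \<le> K * r"
      using eventually_ge_at_top[of 0]
    proof eventually_elim
      case (elim r)
      show ?case
        by (rule nevanlinna_T_leI) (use K elim hypergeo_1F1_holomorphic[OF assms] in auto)
    qed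
    show "\<forall>\<^sub>F r in at_top. 1 \<le> K * r" using K(1) by real_asymp
    show "((\<lambda>r. ln (K * r) / ln r) \<longlongrightarrow> 1) at_top" using K(1) by real_asymp
  qed
  then show ?thesis by (simp only: one_ereal_def)
qed

lemma hypergeo_1F1_polynomial_bound:
  assumes "\<alpha> \<in> \<int>\<^sub>\<le>\<^sub>0"
  obtains C N where "C \<ge> 1" "\<And>z. cmod z \<ge> 1 \<Longrightarrow> cmod (hypergeo_1F1 \<alpha> \<gamma> z) \<le> C * cmod z ^ N"
proof -
  obtain N where N: "\<alpha> = - of_nat N"
    using assms by (rule nonpos_Ints_cases')
  define a where "a n = pochhammer \<alpha> n / (fact n * pochhammer \<gamma> n)" for n
  have "a n = 0" if "n \<notin> {..N}" for n
    using that pochhammer_of_nat_eq_0_lemma[of N n, where ?'a = complex] by (simp add: a_def N)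
  then have eq: "hypergeo_1F1 \<alpha> \<gamma> z = (\<Sum>n\<le>N. a n * z ^ n)" for z
    unfolding hypergeo_1F1_def a_def by (intro suminf_finite) auto
  have "cmod (hypergeo_1F1 \<alpha> \<gamma> z) \<le> (1 + (\<Sum>n\<le>N. cmod (a n))) * cmod z ^ N"
    if z: "cmod z \<ge> 1" for z
  proof -
    have "cmod (hypergeo_1F1 \<alpha> \<gamma> z) \<le> (\<Sum>n\<le>N. cmod (a n * z ^ n))"
      unfolding eq by (rule norm_sum)
    also have "\<dots> \<le> (\<Sum>n\<le>N. cmod (a n) * cmod z ^ N)"
      using z by (intro sum_mono) (auto simp: norm_mult norm_power intro!: mult_left_mono power_increasing)
    also have "\<dots> \<le> (1 + (\<Sum>n\<le>N. cmod (a n))) * cmod z ^ N"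
      by (simp add: sum_distrib_right distrib_right)
    finally show ?thesis .
  qed
  moreover have "1 + (\<Sum>n\<le>N. cmod (a n)) \<ge> 1" by (simp add: sum_nonneg)
  ultimately show thesis using that by blast
qed

lemma nevanlinna_order_hypergeo_1F1_polynomial:
  assumes "\<gamma> \<notin> \<int>\<^sub>\<le>\<^sub>0" "\<alpha> \<in> \<int>\<^sub>\<le>\<^sub>0"
  shows "nevanlinna_order (hypergeo_1F1 \<alpha> \<gamma>) = 0"
proof -
  obtain C N where C: "C \<ge> 1" "\<And>z. cmod z \<ge> 1 \<Longrightarrow> cmod (hypergeo_1F1 \<alpha> \<gamma> z) \<le> C * cmod z ^ N"
    using hypergeo_1F1_polynomial_bound[OF assms(2)] by blast
  \<comment> \<open>The summand 1 keeps \<open>g\<close> at least 1, hence \<open>ln (g r)\<close> nonnegative, even when \<open>C = 1\<close> and \<open>N = 0\<close>.\<close>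
  define g where "g r = ln C + 1 + real N * ln r" for r
  have "nevanlinna_order (hypergeo_1F1 \<alpha> \<gamma>) \<le> ereal 0"
  proof (rule nevanlinna_order_leI)
    show "\<forall>\<^sub>F r in at_top. nevanlinna_T r (hypergeo_1F1 \<alpha> \<gamma>) \<le> g r"
      using eventually_ge_at_top[of 1]
    proof eventually_elim
      case (elim r)
      have "C * r ^ N = exp (ln C + real N * ln r)"
        using elim C(1) by (simp add: exp_add exp_of_nat_mult)
      also have "\<dots> \<le> exp (g r)" by (simp add: g_def)
      finally have "C * r ^ N \<le> exp (g r)" .
      then show ?case
        using elim C(1)
        by (intro nevanlinna_T_leI hypergeo_1F1_holomorphic assms)
           (auto simp: g_def intro!: add_nonneg_nonneg order_trans[OF C(2)])
    qed
    show "\<forall>\<^sub>F r in at_top. 1 \<le> g r"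
      using eventually_ge_at_top[of 1] by eventually_elim (use C(1) in \<open>simp add: g_def\<close>)
    show "((\<lambda>r. ln (g r) / ln r) \<longlongrightarrow> 0) at_top"
    proof (cases "N = 0")
      case True
      then show ?thesis unfolding g_def using C(1) by simp real_asymp
    next
      case False
      then have "real N > 0" by simp
      then show ?thesis unfolding g_def by real_asymp
    qed
  qed
  then show ?thesis by (intro antisym nevanlinna_order_nonneg) (simp only: zero_ereal_def)
qed

text \<open>
  Cauchy's inequality on the circle of radius \<open>r / 2\<close>, where \<open>(r + \<bar>z\<bar>) / (r - \<bar>z\<bar>) = 3\<close>.
\<close>

lemma norm_fps_nth_le_exp_nevanlinna_T:
  fixes F :: "complex fps"
  assumes conv: "fps_conv_radius F = \<infinity>" and r: "r > 0"
  shows "cmod (fps_nth F n) * (r / 2) ^ n \<le> exp (3 * nevanlinna_T r (eval_fps F))"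
proof -
  have holo: "eval_fps F holomorphic_on A" for A
    by (rule holomorphic_on_eval_fps) (simp add: conv)
  have "cmod ((deriv ^^ n) (eval_fps F) 0)
      \<le> fact n * exp (3 * nevanlinna_T r (eval_fps F)) / (r / 2) ^ n"
  proof (rule Cauchy_inequality)
    fix z :: complex assume "cmod (0 - z) = r / 2"
    then have z: "cmod z = r / 2" by simp
    have "(r + cmod z) / (r - cmod z) = 3"
      using r unfolding z by (simp add: field_simps)
    then show "cmod (eval_fps F z) \<le> exp (3 * nevanlinna_T r (eval_fps F))"
      using cmod_le_exp_nevanlinna_T[OF holo, of z r] z r by simp
  qed (use r in \<open>auto intro!: holo holomorphic_on_imp_continuous_on\<close>)
  then show ?thesis
    using r by (simp add: fps_nth_conv_deriv conv norm_divide field_simps)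
qed

lemma nevanlinna_order_hypergeo_1F1_ge_1:
  assumes "\<gamma> \<notin> \<int>\<^sub>\<le>\<^sub>0" "\<alpha> \<notin> \<int>\<^sub>\<le>\<^sub>0"
  shows "nevanlinna_order (hypergeo_1F1 \<alpha> \<gamma>) \<ge> 1"
proof -
  obtain K where K: "K > 0" "\<And>n. 1 / (K ^ n * fact n) \<le> cmod (fps_nth (kummer_fps \<alpha> \<gamma>) n)"
    using norm_kummer_fps_nth_ge[OF assms(2,1)] by blast
  \<comment> \<open>With \<open>n! \<le> n\<^sup>n\<close> the lower bound for the \<open>n\<close>-th term at radius \<open>r n / 2\<close> is
    \<open>(e K n)\<^sup>n / (K n)\<^sup>n = e\<^sup>n\<close>.\<close>
  define r where "r n = 2 * exp 1 * K * real n" for n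
  have T: "real n / 3 \<le> nevanlinna_T (r n) (hypergeo_1F1 \<alpha> \<gamma>)" if n: "n > 0" for n
  proof -
    have "(fact n :: real) \<le> real n ^ n"
      using fact_le_power[of n] by simp
    then have "exp (real n) * fact n \<le> exp (real n) * real n ^ n"
      by simp
    then have "exp (real n) \<le> 1 / (K ^ n * fact n) * (exp 1 * K * real n) ^ n"
      using K(1) by (simp add: power_mult_distrib field_simps flip: exp_of_nat_mult)
    also have "\<dots> \<le> cmod (fps_nth (kummer_fps \<alpha> \<gamma>) n) * (exp 1 * K * real n) ^ n"
      using K by (intro mult_right_mono) auto
    also have "\<dots> = cmod (fps_nth (kummer_fps \<alpha> \<gamma>) n) * (r n / 2) ^ n"
      by (simp add: r_def mult.assoc)
    also have "\<dots> \<le> exp (3 * nevanlinna_T (r n) (hypergeo_1F1 \<alpha> \<gamma>))"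
      unfolding hypergeo_1F1_eq_eval_fps using n K(1)
      by (intro norm_fps_nth_le_exp_nevanlinna_T fps_conv_radius_kummer assms) (simp add: r_def)
    finally show ?thesis by simp
  qed
  have "ereal 1 \<le> nevanlinna_order (hypergeo_1F1 \<alpha> \<gamma>)"
  proof (rule nevanlinna_order_geI)
    show "filterlim r at_top sequentially"
      unfolding r_def using K(1) by real_asymp
    show "\<forall>\<^sub>F n in sequentially. 0 < real n / 3 \<and> real n / 3 \<le> nevanlinna_T (r n) (hypergeo_1F1 \<alpha> \<gamma>)"
      using eventually_gt_at_top[of 0] by eventually_elim (use T in auto)
    show "(\<lambda>n. ln (real n / 3) / ln (r n)) \<longlonglongrightarrow> 1"
      unfolding r_def using K(1) by real_asymp
  qed
  then show ?thesis by (simp only: one_ereal_def)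
qed

theorem theorem3p3:
  fixes \<alpha> \<gamma> :: complex
  assumes "\<gamma> \<notin> \<int>\<^sub>\<le>\<^sub>0"
  shows "(\<alpha> \<notin> \<int>\<^sub>\<le>\<^sub>0 \<longrightarrow> nevanlinna_order (hypergeo_1F1 \<alpha> \<gamma>) = 1) \<and>
         (\<alpha> \<in> \<int>\<^sub>\<le>\<^sub>0 \<longrightarrow> nevanlinna_order (hypergeo_1F1 \<alpha> \<gamma>) = 0)"
proof (intro conjI impI)
  assume "\<alpha> \<notin> \<int>\<^sub>\<le>\<^sub>0"
  then show "nevanlinna_order (hypergeo_1F1 \<alpha> \<gamma>) = 1"
    by (intro antisym nevanlinna_order_hypergeo_1F1_le_1 nevanlinna_order_hypergeo_1F1_ge_1 assms)
next
  assume "\<alpha> \<in> \<int>\<^sub>\<le>\<^sub>0"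
  then show "nevanlinna_order (hypergeo_1F1 \<alpha> \<gamma>) = 0"
    by (rule nevanlinna_order_hypergeo_1F1_polynomial[OF assms])
qed

end
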